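(* Let $K, C \ge 1$ be integers, let $P_1,\dots,P_K$ be pairwise disjoint finite nonempty sets, $\mathcal{V}=P_1\cup\dots\cup P_K$, and let $\mathcal{P}=\{S\subseteq \mathcal{V} : |S\cap P_k|\le 1 \text{ for all } k\in\{1,\dots,K\}\}$. Suppose $f:2^{\mathcal{V}}\to\mathbb{R}_{\ge 0}$ is monotone submodular. Let $G$ be the set of (item, color) pairs constructed by the algorithm TabularGreedy (defined in the context) on input $C$, $P_1,\dots,P_K$, $f$, where each $\arg\max$ is computed exactly (with ties broken arbitrarily), and let $F$ be the function defined in the context. Then $$F(G)\;\ge\;\beta(K,C)\cdot\max_{S\in\mathcal{P}} f(S),\qquad\text{where } \beta(K,C)=1-\left(1-\tfrac1C\right)^C-\binom{K}{2}C^{-1}.$$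
   Context: Notation: $[n]=\{1,\dots,n\}$; $S+e$ means $S\cup\{e\}$. A function $f:2^{\mathcal{V}}\to\mathbb{R}_{\ge0}$ is monotone if $f(S)\le f(S')$ whenever $S\subseteq S'$, and submodular if $f(S\cup\{s\})-f(S)\ge f(S'\cup\{s\})-f(S')$ whenever $S\subseteq S'$ and $s\notin S'$. Elements of $[C]$ are called colors. For $S\subseteq\mathcal{V}\times[C]$ and $\vec c=(c_1,\dots,c_K)\in[C]^K$ define $\mathrm{sample}_{\vec c}(S)=\bigcup_{k=1}^K\{x\in P_k : (x,c_k)\in S\}\subseteq\mathcal{V}$. Define $F(S)=\mathbb{E}_{\vec c}[f(\mathrm{sample}_{\vec c}(S))]$, where $c_1,\dots,c_K$ are independent and uniform on $[C]$. Algorithm TabularGreedy: start with $G:=\emptyset$. For $c=1,2,\dots,C$ (outer loop) and, for each $c$, for $k=1,2,\dots,K$ (inner loop): choose $g_{k,c}\in\arg\max_{x\in P_k\times\{c\}}F(G+x)$ and set $G:=G+g_{k,c}$. The set $G$ in the claim is the final set $G=\{g_{k,c}:k\in[K],c\in[C]\}$. (The algorithm finally draws $\vec c$ uniformly from $[C]^K$ and outputs $\mathrm{sample}_{\vec c}(G)$, so $F(G)$ is the expected value of $f$ on the output.) *)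

theory Defs
  imports "HOL-Probability.Probability" "HOL-Probability.Product_PMF"
begin

definition submodular_on :: "'a set \<Rightarrow> ('a set \<Rightarrow> real) \<Rightarrow> bool" where
  "submodular_on V f \<longleftrightarrow>
     (\<forall>S S' s. S \<subseteq> S' \<and> S' \<subseteq> V \<and> s \<in> V \<and> s \<notin> S' \<longrightarrow>
        f (S \<union> {s}) - f S \<ge> f (S' \<union> {s}) - f S')"

definition ground_set :: "nat \<Rightarrow> (nat \<Rightarrow> 'a set) \<Rightarrow> 'a set" where
  "ground_set K P = (\<Union>k\<in>{1..K}. P k)"

definition feasible_sets :: "nat \<Rightarrow> (nat \<Rightarrow> 'a set) \<Rightarrow> 'a set set" where
  "feasible_sets K P = {S. S \<subseteq> ground_set K P \<and> (\<forall>k\<in>{1..K}. card (S \<inter> P k) \<le> 1)}"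

text \<open>A colour vector in \<open>[C]\<^sup>K\<close> is a function whose values outside \<open>{1..K}\<close> are irrelevant.\<close>

definition sample :: "nat \<Rightarrow> (nat \<Rightarrow> 'a set) \<Rightarrow> (nat \<Rightarrow> nat) \<Rightarrow> ('a \<times> nat) set \<Rightarrow> 'a set" where
  "sample K P c S = (\<Union>k\<in>{1..K}. {x \<in> P k. (x, c k) \<in> S})"

text \<open>The product measure makes the coordinates indexed by \<open>{1..K}\<close> independent and uniform on
  \<open>{1..C}\<close>; the coordinates outside \<open>{1..K}\<close> get the dummy value \<open>undefined\<close>.\<close>

definition expected_value ::
  "nat \<Rightarrow> nat \<Rightarrow> (nat \<Rightarrow> 'a set) \<Rightarrow> ('a set \<Rightarrow> real) \<Rightarrow> ('a \<times> nat) set \<Rightarrow> real" where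
  "expected_value K C P f S =
     measure_pmf.expectation (Pi_pmf {1..K} undefined (\<lambda>_. pmf_of_set {1..C}))
       (\<lambda>c. f (sample K P c S))"

text \<open>\<open>greedy_run F P steps G H\<close>: starting from \<open>G\<close>, processing the loop iterations \<open>(k, c)\<close>
  listed in \<open>steps\<close> can end in \<open>H\<close>. It is a relation because ties may be broken arbitrarily.\<close>

inductive greedy_run ::
  "(('a \<times> nat) set \<Rightarrow> real) \<Rightarrow> (nat \<Rightarrow> 'a set) \<Rightarrow> (nat \<times> nat) list \<Rightarrow>
   ('a \<times> nat) set \<Rightarrow> ('a \<times> nat) set \<Rightarrow> bool"
  for F :: "('a \<times> nat) set \<Rightarrow> real" and P :: "nat \<Rightarrow> 'a set" where
  finish: "greedy_run F P [] G G"
| step: "is_arg_max (\<lambda>x. F (G \<union> {x})) (\<lambda>x. x \<in> P k \<times> {c}) g \<Longrightarrow>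
         greedy_run F P steps (G \<union> {g}) H \<Longrightarrow>
         greedy_run F P ((k, c) # steps) G H"

definition tabular_greedy ::
  "nat \<Rightarrow> nat \<Rightarrow> (nat \<Rightarrow> 'a set) \<Rightarrow> ('a set \<Rightarrow> real) \<Rightarrow> ('a \<times> nat) set \<Rightarrow> bool" where
  "tabular_greedy K C P f G \<longleftrightarrow>
     greedy_run (expected_value K C P f) P
       [(k, c). c \<leftarrow> [1..<Suc C], k \<leftarrow> [1..<Suc K]] {} G"

definition tg_beta :: "nat \<Rightarrow> nat \<Rightarrow> real" where
  "tg_beta K C = 1 - (1 - 1 / real C) ^ C - real (K choose 2) * inverse (real C)"

end

theory Submission
  imports Defs
begin

text \<open>Let \<open>S\<^sup>*\<close> be optimal, enlarged so that there is one element \<open>x k\<close> of \<open>S\<^sup>*\<close> in each \<open>P k\<close>. A greedy step in row \<open>k\<close>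
  gains at least \<open>1/C\<close> times the expected marginal value of \<open>x k\<close> over the current sample. Summing
  over a column that leads from \<open>A\<close> to \<open>B\<close> gives \<open>F B - F A \<ge> (f S\<^sup>* - F B) / C\<close>, so the deficit
  \<open>f S\<^sup>* - F\<close> shrinks by the factor \<open>C / (C + 1)\<close> per column; this suffices for \<open>K \<ge> 2\<close> because
  \<open>(C / (C + 1))^C \<le> (1 - 1/C)^C + 1/C\<close>. For \<open>K = 1\<close> a column is a single step, so that \<open>F B\<close> on the
  right improves to \<open>F A\<close> and the factor to \<open>1 - 1/C\<close>.\<close>

section \<open>Composition of runs and a numerical inequality\<close>

lemma greedy_run_append:
  assumes "greedy_run F P (xs @ ys) A B"
  obtains M where "greedy_run F P xs A M" "greedy_run F P ys M B"
proof -
  have "\<exists>M. greedy_run F P xs A M \<and> greedy_run F P ys M B"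
    using assms
  proof (induction xs arbitrary: A)
    case Nil
    then show ?case by (auto intro: greedy_run.finish)
  next
    case (Cons x xs)
    from Cons.prems show ?case
    proof (cases rule: greedy_run.cases)
      case (step k c g steps)
      then show ?thesis
        using Cons.IH[of "A \<union> {g}"] by (metis append_Cons greedy_run.step list.inject)
    qed auto
  qed
  then show thesis using that by blast
qed

text \<open>On [0,1] the C-th power has Lipschitz constant C, and the two bases differ by
  1/(C(C+1)), so the powers differ by at most 1/(C+1).\<close>

lemma power_ratio_le:
  fixes C :: nat
  assumes "C \<ge> 1"
  shows "(real C / (real C + 1)) ^ C \<le> (1 - 1 / real C) ^ C + 1 / real C"
proof -
  define a b where "a = real C / (real C + 1)" and "b = 1 - 1 / real C"
  have C: "real C \<ge> 1" using assms by simp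
  have ab: "0 \<le> b" "a \<le> 1" "0 \<le> a" and d: "a - b = 1 / (real C * (real C + 1))"
    using C by (auto simp: a_def b_def field_simps)
  have "b \<le> a" using d C by (smt (verit) divide_nonneg_nonneg mult_nonneg_nonneg)
  have "a ^ C - b ^ C = (a - b) * (\<Sum>i<C. a ^ i * b ^ (C - Suc i))"
    by (simp add: diff_power_eq_sum mult.commute power_diff_sumr2)
  also have "\<dots> \<le> (a - b) * (\<Sum>i<C. 1)"
    using ab \<open>b \<le> a\<close> by (intro mult_left_mono sum_mono mult_le_one power_le_one) auto
  also have "\<dots> \<le> 1 / real C"
    using C by (simp add: d divide_le_eq)
  finally show ?thesis by (simp add: a_def b_def)
qed

section \<open>Averages over uniformly random colourings\<close>

definition colourings :: "nat \<Rightarrow> nat \<Rightarrow> (nat \<Rightarrow> nat) set" where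
  "colourings K C = PiE_dflt {1..K} undefined (\<lambda>_. {1..C})"

definition average :: "'b set \<Rightarrow> ('b \<Rightarrow> real) \<Rightarrow> real" where
  "average A h = (\<Sum>a\<in>A. h a) / card A"

lemma average_mono: "(\<And>a. a \<in> A \<Longrightarrow> g a \<le> h a) \<Longrightarrow> average A g \<le> average A h"
  unfolding average_def by (intro divide_right_mono sum_mono) auto

lemma average_diff: "average A (\<lambda>a. g a - h a) = average A g - average A h"
  by (simp add: average_def sum_subtractf diff_divide_distrib)

lemma average_sum: "average A (\<lambda>a. \<Sum>i\<in>I. h i a) = (\<Sum>i\<in>I. average A (h i))"
  unfolding average_def by (subst sum.swap) (simp add: sum_divide_distrib)

lemma average_const: "finite A \<Longrightarrow> A \<noteq> {} \<Longrightarrow> average A (\<lambda>_. r) = r"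
  by (simp add: average_def)

lemma finite_colourings: "finite (colourings K C)"
  by (simp add: colourings_def finite_PiE_dflt)

lemma colourings_nonempty: "C \<ge> 1 \<Longrightarrow> colourings K C \<noteq> {}"
  by (auto simp: colourings_def PiE_dflt_empty_iff)

lemma colourings_upd:
  "c \<in> colourings K C \<Longrightarrow> k \<in> {1..K} \<Longrightarrow> y \<in> {1..C} \<Longrightarrow> c(k := y) \<in> colourings K C"
  by (auto simp: colourings_def PiE_dflt_def)

text \<open>A product of uniform distributions is uniform on the product set, which turns the
  expectation into a finite sum. The default \<open>undefined\<close> in \<open>colourings\<close>
  matches that of the product measure.\<close>

lemma expected_value_average:
  assumes "C \<ge> 1"
  shows "expected_value K C P f S = average (colourings K C) (\<lambda>c. f (sample K P c S))"
proof -
  have "Pi_pmf {1..K} undefined (\<lambda>_. pmf_of_set {1..C}) = pmf_of_set (colourings K C)"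
    unfolding colourings_def using assms by (intro Pi_pmf_of_set) auto
  then show ?thesis
    using assms
    by (simp add: expected_value_def average_def integral_pmf_of_set finite_colourings
        colourings_nonempty)
qed

text \<open>The colour of row \<open>k\<close> is uniform and independent of the others: the event
  \<open>c k = y\<close> has probability 1/C, and conditioning on it amounts to overwriting
  \<open>c k\<close> by \<open>y\<close>.\<close>

lemma average_fixed_colour:
  assumes k: "k \<in> {1..K}" and y: "y \<in> {1..C}"
  shows "average (colourings K C) (\<lambda>c. if c k = y then h c else 0)
    = average (colourings K C) (\<lambda>c. h (c(k := y))) / C"
proof -
  let ?\<Omega> = "colourings K C"
  \<comment> \<open>Overwriting forgets only the colour of row \<open>k\<close>, so each fibre has
    one member per colour.\<close>
  have fibre: "card {c \<in> ?\<Omega>. c(k := y) = e} = C" if e: "e \<in> ?\<Omega>" "e k = y" for e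
  proof -
    have "{c \<in> ?\<Omega>. c(k := y) = e} = (\<lambda>z. e(k := z)) ` {1..C}"
    proof (intro equalityI subsetI)
      fix c assume c: "c \<in> {c \<in> ?\<Omega>. c(k := y) = e}"
      then have "c = e(k := c k)" "c k \<in> {1..C}"
        using k by (auto simp: colourings_def PiE_dflt_def)
      then show "c \<in> (\<lambda>z. e(k := z)) ` {1..C}" by blast
    next
      fix c assume "c \<in> (\<lambda>z. e(k := z)) ` {1..C}"
      then show "c \<in> {c \<in> ?\<Omega>. c(k := y) = e}"
        using e colourings_upd[OF e(1) k] by auto
    qed
    moreover have "inj_on (\<lambda>z. e(k := z)) {1..C}"
      by (rule inj_onI) (metis fun_upd_same)
    ultimately show ?thesis by (simp add: card_image)
  qed
  have "(\<Sum>c\<in>?\<Omega>. h (c(k := y)))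
      = (\<Sum>e\<in>{e \<in> ?\<Omega>. e k = y}. \<Sum>c\<in>{c \<in> ?\<Omega>. c(k := y) = e}. h (c(k := y)))"
    by (rule sum.group[symmetric]) (use k y in \<open>auto simp: finite_colourings colourings_upd\<close>)
  also have "\<dots> = (\<Sum>e\<in>{e \<in> ?\<Omega>. e k = y}. real C * h e)"
  proof (rule sum.cong[OF refl])
    fix e assume "e \<in> {e \<in> ?\<Omega>. e k = y}"
    then show "(\<Sum>c\<in>{c \<in> ?\<Omega>. c(k := y) = e}. h (c(k := y))) = real C * h e"
      using fibre[of e] by simp
  qed
  also have "\<dots> = real C * (\<Sum>c\<in>?\<Omega>. if c k = y then h c else 0)"
    unfolding sum_distrib_left sum.inter_filter[OF finite_colourings]
    by (intro sum.cong) auto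
  finally show ?thesis using y by (simp add: average_def)
qed

section \<open>Marginal values and samples\<close>

locale tabular =
  fixes K C :: nat and P :: "nat \<Rightarrow> 'a set" and f :: "'a set \<Rightarrow> real"
  assumes K: "K \<ge> 1" and C: "C \<ge> 1"
    and disjoint: "disjoint_family_on P {1..K}"
    and P: "\<And>k. k \<in> {1..K} \<Longrightarrow> finite (P k) \<and> P k \<noteq> {}"
    and nonneg: "\<And>S. S \<subseteq> ground_set K P \<Longrightarrow> f S \<ge> 0"
    and mono: "mono_on (Pow (ground_set K P)) f"
    and submodular: "submodular_on (ground_set K P) f"
begin

abbreviation "V \<equiv> ground_set K P"
abbreviation "\<Omega> \<equiv> colourings K C"
abbreviation "F \<equiv> expected_value K C P f"

lemmas F_average = expected_value_average[OF C]

lemma P_subset: "k \<in> {1..K} \<Longrightarrow> x \<in> P k \<Longrightarrow> x \<in> V"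
  by (auto simp: ground_set_def)

lemma f_mono: "S \<subseteq> T \<Longrightarrow> T \<subseteq> V \<Longrightarrow> f S \<le> f T"
  using mono by (auto simp: mono_on_def)

text \<open>\<open>submodular_on\<close> speaks only of \<open>s\<close> outside \<open>T\<close>;
  for \<open>s\<close> in \<open>T\<close> the left side is 0 and monotonicity makes the right side
  nonnegative.\<close>

lemma marginal_antimono:
  assumes "S \<subseteq> T" "T \<subseteq> V" "s \<in> V"
  shows "f (insert s T) - f T \<le> f (insert s S) - f S"
proof (cases "s \<in> T")
  case True
  then show ?thesis using f_mono[of S "insert s S"] assms by (auto simp: insert_absorb)
next
  case False
  then show ?thesis using submodular assms by (auto simp: submodular_on_def)
qed

lemma f_union_le_sum:
  assumes "finite I" "x ` I \<subseteq> V" "A \<subseteq> V"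
  shows "f (A \<union> x ` I) - f A \<le> (\<Sum>i\<in>I. f (insert (x i) A) - f A)"
  using assms
proof (induction I rule: finite_induct)
  case (insert i I)
  then have "f (insert (x i) (A \<union> x ` I)) - f (A \<union> x ` I) \<le> f (insert (x i) A) - f A"
    by (intro marginal_antimono) auto
  with insert show ?case by simp
qed simp

lemma sample_subset: "sample K P c S \<subseteq> V"
  by (auto simp: sample_def ground_set_def)

lemma sample_mono: "S \<subseteq> T \<Longrightarrow> sample K P c S \<subseteq> sample K P c T"
  by (auto simp: sample_def)

lemma F_mono: "S \<subseteq> T \<Longrightarrow> F S \<le> F T"
  unfolding F_average by (intro average_mono f_mono sample_mono sample_subset)

lemma F_nonneg: "F S \<ge> 0"
  unfolding F_average average_def by (intro divide_nonneg_nonneg sum_nonneg nonneg sample_subset) auto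

text \<open>Disjointness makes \<open>k\<close> the only row containing \<open>x\<close>, so the new
  pair matters only through \<open>c k\<close>.\<close>

lemma sample_insert:
  assumes "k \<in> {1..K}" "x \<in> P k"
  shows "sample K P c (insert (x, y) A)
    = (if c k = y then insert x (sample K P c A) else sample K P c A)"
proof -
  have row: "j = k" if "j \<in> {1..K}" "x \<in> P j" for j
    using that assms disjoint by (meson disjoint_family_onD disjoint_iff)
  have "z \<in> sample K P c (insert (x, y) A) \<longleftrightarrow> z = x \<and> c k = y \<or> z \<in> sample K P c A" for z
    using assms unfolding sample_def by (blast dest: row)
  then show ?thesis by (intro set_eqI) (simp only: insert_iff split: if_split, blast)
qed

section \<open>Greedy gains within one column\<close>

abbreviation gain :: "('a \<times> nat) set \<Rightarrow> 'a \<Rightarrow> real" where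
  "gain A x \<equiv> average \<Omega> (\<lambda>c. f (insert x (sample K P c A)) - f (sample K P c A))"

lemma gain_antimono:
  "A \<subseteq> B \<Longrightarrow> x \<in> V \<Longrightarrow> gain B x \<le> gain A x"
  by (intro average_mono marginal_antimono sample_mono sample_subset)

text \<open>If \<open>c k = y\<close> then row \<open>k\<close> contributes nothing to the sample of \<open>A\<close>; by submodularity the marginal
  value of \<open>x\<close> conditioned on this event, of probability \<open>1/C\<close>, is at least the unconditional one.\<close>

lemma F_insert_ge:
  assumes k: "k \<in> {1..K}" and y: "y \<in> {1..C}" and x: "x \<in> P k"
    and free: "A \<inter> P k \<times> {y} = {}"
  shows "gain A x / C \<le> F (insert (x, y) A) - F A"
proof -
  define h where "h c = f (insert x (sample K P c A)) - f (sample K P c A)" for c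
  have xV: "x \<in> V" using k x by (rule P_subset)
  have "F (insert (x, y) A) - F A = average \<Omega> (\<lambda>c. if c k = y then h c else 0)"
    unfolding F_average average_diff[symmetric] h_def sample_insert[OF k x]
    by (rule arg_cong[where f = "average \<Omega>"]) auto
  also have "\<dots> = average \<Omega> (\<lambda>c. h (c(k := y))) / C"
    by (rule average_fixed_colour[OF k y])
  finally have eq: "F (insert (x, y) A) - F A = average \<Omega> (\<lambda>c. h (c(k := y))) / C" .
  have "h c \<le> h (c(k := y))" for c
    unfolding h_def
  proof (rule marginal_antimono[OF _ sample_subset xV])
    show "sample K P (c(k := y)) A \<subseteq> sample K P c A"
      using free by (auto simp: sample_def split: if_splits)
  qed
  then show ?thesis
    unfolding eq h_def[symmetric] by (intro divide_right_mono average_mono) auto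
qed

text \<open>Gains are measured against a common set \<open>D\<close>: if \<open>D\<close> contains
  the final \<open>B\<close>, its gains are at most those at every intermediate set, so one
  \<open>D\<close> serves all steps. A column of a single step can also be measured against its
  start \<open>A\<close>. The upper inclusion for \<open>B\<close> ensures that later columns start
  empty.\<close>

lemma greedy_column:
  assumes "greedy_run F P (map (\<lambda>k. (k, y)) ks) A B" "distinct ks" "set ks \<subseteq> {1..K}"
    and "y \<in> {1..C}" "\<And>k. k \<in> set ks \<Longrightarrow> x k \<in> P k"
    and "\<And>k. k \<in> set ks \<Longrightarrow> A \<inter> P k \<times> {y} = {}"
  shows "A \<subseteq> B \<and> B \<subseteq> A \<union> UNIV \<times> {y} \<and>
    (\<forall>D. B \<subseteq> D \<or> length ks = 1 \<and> D = A \<longrightarrow> (\<Sum>k\<in>set ks. gain D (x k)) / C \<le> F B - F A)"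
  using assms
proof (induction ks arbitrary: A)
  case Nil
  then have "A = B" by (auto elim: greedy_run.cases)
  then show ?case by simp
next
  case (Cons k ks)
  from Cons.prems(1) obtain g where
    g: "is_arg_max (\<lambda>z. F (A \<union> {z})) (\<lambda>z. z \<in> P k \<times> {y}) g"
    and run: "greedy_run F P (map (\<lambda>k. (k, y)) ks) (A \<union> {g}) B"
    by (auto elim: greedy_run.cases)
  have k: "k \<in> {1..K}" "x k \<in> P k" "k \<notin> set ks"
    using Cons.prems(2,3,5) by auto
  then have "x k \<in> V" using P_subset by blast
  have gP: "g \<in> P k \<times> {y}" using g by (auto simp: is_arg_max_def)
  \<comment> \<open>The reference element \<open>x k\<close> in colour \<open>y\<close> is a
    candidate in this step.\<close>
  have "F (insert (x k, y) A) \<le> F (insert g A)"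
    using g k by (force simp: is_arg_max_linorder)
  then have step: "gain A (x k) / C \<le> F (insert g A) - F A"
    using F_insert_ge[OF k(1) Cons.prems(4) k(2) Cons.prems(6)[of k]] by simp
  \<comment> \<open>Since rows are disjoint, choosing \<open>g\<close> in row \<open>k\<close>
    leaves the remaining rows of this column empty.\<close>
  have "(A \<union> {g}) \<inter> P j \<times> {y} = {}" if "j \<in> set ks" for j
  proof -
    have "P k \<inter> P j = {}" using k that Cons.prems(3) by (intro disjoint_family_onD[OF disjoint]) auto
    then show ?thesis using gP that Cons.prems(6)[of j] by auto
  qed
  then have IH: "A \<union> {g} \<subseteq> B" "B \<subseteq> (A \<union> {g}) \<union> UNIV \<times> {y}"
    "\<And>D. B \<subseteq> D \<Longrightarrow> (\<Sum>k\<in>set ks. gain D (x k)) / C \<le> F B - F (A \<union> {g})"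
    using Cons.IH[OF run] Cons.prems(2-5) by auto
  have "(\<Sum>k\<in>set (k # ks). gain D (x k)) / C \<le> F B - F A"
    if "B \<subseteq> D \<or> length (k # ks) = 1 \<and> D = A" for D
  proof (cases "B \<subseteq> D")
    case True
    then have "gain D (x k) / C \<le> gain A (x k) / C"
      using IH(1) \<open>x k \<in> V\<close> by (intro divide_right_mono gain_antimono) auto
    then show ?thesis using step IH(3)[OF True] k by (simp add: add_divide_distrib)
  next
    case False
    then have "ks = []" "D = A" using that by auto
    moreover have "F (insert g A) \<le> F B" using IH(1) by (intro F_mono) auto
    ultimately show ?thesis using step by simp
  qed
  then show ?case using IH(1,2) gP by auto
qed

text \<open>For each colouring, monotonicity allows the sample to be added to the selected elements,
  and submodularity splits the resulting increase into single marginals; averaging yields the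
  gains.\<close>

lemma sum_gain_ge:
  assumes "\<And>k. k \<in> {1..K} \<Longrightarrow> x k \<in> P k"
  shows "f (x ` {1..K}) - F D \<le> (\<Sum>k=1..K. gain D (x k))"
proof -
  have xV: "x ` {1..K} \<subseteq> V" using assms P_subset by blast
  have "f (x ` {1..K}) - F D = average \<Omega> (\<lambda>c. f (x ` {1..K}) - f (sample K P c D))"
    by (simp add: F_average average_diff average_const finite_colourings colourings_nonempty[OF C])
  also have "\<dots> \<le> average \<Omega>
      (\<lambda>c. \<Sum>k=1..K. f (insert (x k) (sample K P c D)) - f (sample K P c D))"
  proof (rule average_mono)
    fix c
    have "f (x ` {1..K}) \<le> f (sample K P c D \<union> x ` {1..K})"
      using xV sample_subset by (intro f_mono) auto
    also have "\<dots> - f (sample K P c D)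
        \<le> (\<Sum>k=1..K. f (insert (x k) (sample K P c D)) - f (sample K P c D))"
      using xV sample_subset by (intro f_union_le_sum) auto
    finally show "f (x ` {1..K}) - f (sample K P c D)
        \<le> (\<Sum>k=1..K. f (insert (x k) (sample K P c D)) - f (sample K P c D))" by simp
  qed
  finally show ?thesis by (simp add: average_sum)
qed

section \<open>Contraction of the deficit per column\<close>

definition ratio :: real where
  "ratio = (if K = 1 then 1 - 1 / C else C / (C + 1))"

lemma ratio_nonneg: "ratio \<ge> 0"
  using C by (simp add: ratio_def)

text \<open>For K = 1 the binomial term vanishes and equality holds. For larger K it is at least
  1/C, which absorbs the loss in \<open>power_ratio_le\<close>.\<close>

lemma tg_beta_le: "tg_beta K C \<le> 1 - ratio ^ C"
proof (cases "K = 1")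
  case True
  then show ?thesis unfolding tg_beta_def ratio_def by (simp add: binomial_eq_0)
next
  case False
  then have "K choose 2 \<ge> 1" using K by (simp add: Suc_le_eq zero_less_binomial)
  then have "1 / real C \<le> real (K choose 2) * inverse (real C)"
    using C by (simp add: field_simps)
  then show ?thesis using False power_ratio_le[OF C] by (simp add: tg_beta_def ratio_def add.commute)
qed

lemma column_contraction:
  assumes run: "greedy_run F P (map (\<lambda>k. (k, y)) [1..<Suc K]) A B"
    and y: "y \<in> {1..C}" and free: "A \<inter> UNIV \<times> {y} = {}"
    and x: "\<And>k. k \<in> {1..K} \<Longrightarrow> x k \<in> P k"
  shows "f (x ` {1..K}) - F B \<le> ratio * (f (x ` {1..K}) - F A)"
proof -
  have set: "set [1..<Suc K] = {1..K}" by auto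
  have free': "A \<inter> P k \<times> {y} = {}" for k using free by auto
  note column = greedy_column[OF run distinct_upt _ y, unfolded set, OF subset_refl x free']
  have col: "(\<Sum>k=1..K. gain D (x k)) / C \<le> F B - F A" if "B \<subseteq> D \<or> K = 1 \<and> D = A" for D
    using column that unfolding length_upt diff_Suc_1 by blast
  have main: "(f (x ` {1..K}) - F D) / C \<le> F B - F A" if "B \<subseteq> D \<or> K = 1 \<and> D = A" for D
    using divide_right_mono[OF sum_gain_ge[of x D, OF x], of "real C"] col[OF that] by simp
  let ?o = "f (x ` {1..K})"
  show ?thesis
  proof (cases "K = 1")
    case True
    then have "(?o - F A) / C \<le> F B - F A" using main[of A] by blast
    moreover have "ratio = 1 - 1 / C" using True unfolding ratio_def by simp
    ultimately show ?thesis by (simp only: left_diff_distrib) simp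
  next
    case False
    \<comment> \<open>With \<open>D = B\<close> the new value occurs on both sides; solving for the
      new deficit produces the factor C/(C+1).\<close>
    have "(?o - F B) / C \<le> F B - F A" using main[of B] by blast
    then have "?o - F B \<le> C * (F B - F A)" using C by (simp only: pos_divide_le_eq mult.commute)
    then have "(C + 1) * (?o - F B) \<le> C * (?o - F A)" by (simp add: distrib_right right_diff_distrib)
    moreover have "ratio = C / (C + 1)" using False unfolding ratio_def by simp
    ultimately show ?thesis by (simp add: pos_le_divide_eq mult.commute)
  qed
qed

lemma tabular_greedy_ge:
  assumes x: "\<And>k. k \<in> {1..K} \<Longrightarrow> x k \<in> P k"
    and run: "tabular_greedy K C P f G"
  shows "(1 - ratio ^ C) * f (x ` {1..K}) \<le> F G"
proof -
  \<comment> \<open>The induction over columns also tracks the colours used, because the next column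
    is analysed under the condition that its colour is still absent.\<close>
  have "B \<subseteq> UNIV \<times> {1..n} \<and> f (x ` {1..K}) - F B \<le> ratio ^ n * f (x ` {1..K})"
    if "greedy_run F P [(k, c). c \<leftarrow> [1..<Suc n], k \<leftarrow> [1..<Suc K]] {} B" "n \<le> C" for n B
    using that
  proof (induction n arbitrary: B)
    case 0
    then have "B = {}" by (auto elim: greedy_run.cases)
    \<comment> \<open>Before the first column the deficit is at most the target value because
      \<open>F\<close> is nonnegative.\<close>
    then show ?case using F_nonneg[of "{}"] by simp
  next
    case (Suc n)
    from Suc.prems(1) have "greedy_run F P ([(k, c). c \<leftarrow> [1..<Suc n], k \<leftarrow> [1..<Suc K]]
        @ map (\<lambda>k. (k, Suc n)) [1..<Suc K]) {} B"
      by simp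
    then obtain A where A: "greedy_run F P [(k, c). c \<leftarrow> [1..<Suc n], k \<leftarrow> [1..<Suc K]] {} A"
      and AB: "greedy_run F P (map (\<lambda>k. (k, Suc n)) [1..<Suc K]) A B"
      by (rule greedy_run_append)
    have IH: "A \<subseteq> UNIV \<times> {1..n}" "f (x ` {1..K}) - F A \<le> ratio ^ n * f (x ` {1..K})"
      using Suc.IH[OF A] Suc.prems(2) by auto
    have "B \<subseteq> A \<union> UNIV \<times> {Suc n}"
    proof (rule greedy_column[THEN conjunct2, THEN conjunct1, OF AB distinct_upt])
      show "A \<inter> P k \<times> {Suc n} = {}" for k using IH(1) by auto
      show "x k \<in> P k" if "k \<in> set [1..<Suc K]" for k using that by (intro x) auto
    qed (use Suc.prems(2) in auto)
    then have "B \<subseteq> UNIV \<times> {1..Suc n}" using IH(1) by fastforce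
    moreover have "f (x ` {1..K}) - F B \<le> ratio * (f (x ` {1..K}) - F A)"
      using Suc.prems(2) IH(1) x by (intro column_contraction[OF AB]) auto
    ultimately show ?case
      using mult_left_mono[OF IH(2) ratio_nonneg] by (simp add: mult.assoc)
  qed
  from this[of C G] run show ?thesis
    by (simp add: tabular_greedy_def algebra_simps del: upt_Suc)
qed

section \<open>From selections to feasible sets\<close>

lemma feasible_subset_selection:
  assumes "S \<in> feasible_sets K P"
  obtains x where "\<And>k. k \<in> {1..K} \<Longrightarrow> x k \<in> P k" "S \<subseteq> x ` {1..K}"
proof -
  have "\<exists>z. z \<in> P k \<and> S \<inter> P k \<subseteq> {z}" if k: "k \<in> {1..K}" for k
  proof (cases "S \<inter> P k = {}")
    case True
    \<comment> \<open>A row missed by \<open>S\<close> is filled with an arbitrary element; by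
      monotonicity this cannot lower the value of \<open>f\<close>.\<close>
    then show ?thesis using P[OF k] by auto
  next
    case False
    moreover have "card (S \<inter> P k) \<le> 1" using assms k by (auto simp: feasible_sets_def)
    moreover have "finite (S \<inter> P k)" using P[OF k] by auto
    ultimately have "card (S \<inter> P k) = 1" by (metis One_nat_def card_0_eq le_Suc_eq le_zero_eq)
    then obtain z where "S \<inter> P k = {z}" by (rule card_1_singletonE)
    then show ?thesis by auto
  qed
  then obtain x where x: "\<And>k. k \<in> {1..K} \<Longrightarrow> x k \<in> P k \<and> S \<inter> P k \<subseteq> {x k}" by metis
  moreover have "S \<subseteq> x ` {1..K}"
  proof
    fix z assume "z \<in> S"
    then obtain k where "k \<in> {1..K}" "z \<in> P k"
      using assms unfolding feasible_sets_def ground_set_def by blast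
    then show "z \<in> x ` {1..K}" using x \<open>z \<in> S\<close> by blast
  qed
  ultimately show thesis using that by blast
qed

lemma tabular_greedy_ge_feasible:
  assumes "tabular_greedy K C P f G" "S \<in> feasible_sets K P"
  shows "tg_beta K C * f S \<le> F G"
proof -
  obtain x where x: "\<And>k. k \<in> {1..K} \<Longrightarrow> x k \<in> P k" and S: "S \<subseteq> x ` {1..K}"
    using feasible_subset_selection[OF assms(2)] by blast
  have xV: "x ` {1..K} \<subseteq> V" using x P_subset by blast
  have "ratio ^ C \<le> 1"
    using ratio_nonneg by (intro power_le_one) (auto simp: ratio_def)
  \<comment> \<open>\<open>tg_beta\<close> may be negative, so the constant is raised first, with
    \<open>f S\<close> nonnegative; only then is \<open>S\<close> enlarged, under a nonnegative
    factor.\<close>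
  have "tg_beta K C * f S \<le> (1 - ratio ^ C) * f S"
    using S xV by (intro mult_right_mono tg_beta_le nonneg) auto
  also have "\<dots> \<le> (1 - ratio ^ C) * f (x ` {1..K})"
    using \<open>ratio ^ C \<le> 1\<close> by (intro mult_left_mono f_mono S xV) auto
  also have "\<dots> \<le> F G" by (rule tabular_greedy_ge[OF x assms(1)])
  finally show ?thesis .
qed

end

theorem theorem3:
  fixes K C :: nat
    and P :: "nat \<Rightarrow> 'a set"
    and f :: "'a set \<Rightarrow> real"
    and G :: "('a \<times> nat) set"
  assumes "K \<ge> 1" and "C \<ge> 1"
    and "disjoint_family_on P {1..K}"
    and "\<And>k. k \<in> {1..K} \<Longrightarrow> finite (P k) \<and> P k \<noteq> {}"
    and "\<And>S. S \<subseteq> ground_set K P \<Longrightarrow> f S \<ge> 0"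
    and "mono_on (Pow (ground_set K P)) f"
    and "submodular_on (ground_set K P) f"
    and "tabular_greedy K C P f G"
  shows "expected_value K C P f G \<ge> tg_beta K C * Max (f ` feasible_sets K P)"
proof -
  interpret tabular K C P f
    using assms by unfold_locales auto
  have "finite (ground_set K P)" using P by (auto simp: ground_set_def)
  then have "finite (feasible_sets K P)"
    by (rule rev_finite_subset[OF finite_Pow_iff[THEN iffD2]]) (auto simp: feasible_sets_def)
  moreover have "{} \<in> feasible_sets K P" by (simp add: feasible_sets_def)
  \<comment> \<open>The maximum is attained, so the bound for single feasible sets suffices.\<close>
  ultimately have "Max (f ` feasible_sets K P) \<in> f ` feasible_sets K P"
    by (intro Max_in) auto
  then show ?thesis using tabular_greedy_ge_feasible[OF assms(8)] by auto
qed

end
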